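(* Let $f:\mathbb{R}^{n_1}\times\cdots\times\mathbb{R}^{n_m}\to\mathbb{R}$ be continuously differentiable and jointly convex with respect to all arguments, let $X^i\subseteq\mathbb{R}^{n_i}$, $i=1,\ldots,m$, be non-empty, compact and convex, and let $X=X^1\times\cdots\times X^m$. Assume that $\nabla f$ is Lipschitz continuous on $X$ with Lipschitz constant $L\in\mathbb{R}_+$, i.e. $\|\nabla f(x)-\nabla f(y)\|\le L\|x-y\|$ for all $x,y\in X$. If $$c>\frac{m-1}{2m-1}\sqrt{m}\,L,$$ then for any initial point $x_0\in X$ the sequence $(x_k)_{k\ge 0}$ generated by the regularized Jacobi iteration $$x^i_{k+1}=\arg\min_{z^i\in X^i}\left\{f(z^i,x^{-i}_k)+c\|z^i-x^i_k\|^2\right\},\quad i=1,\ldots,m,\ k\ge 0,$$ satisfies $\lim_{k\to\infty}\mathrm{dist}(x_k,X^* )=0$, where $X^*=\arg\min_{x\in X}f(x)$ is the set of minimizers of the problem $\mathcal{P}:\ \min_{x\in X}f(x)$.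
   Context: Vectors $x\in\mathbb{R}^n$, $n=\sum_{i=1}^m n_i$, are partitioned as $x=(x^1,\ldots,x^m)$ with $x^i\in\mathbb{R}^{n_i}$. The vector $x^{-i}$ collects all blocks of $x$ except the $i$-th, and $f(z^i,x^{-i})$ is the value of $f$ when the $i$-th block is $z^i$ and the other blocks are those of $x$. $\|\cdot\|$ is the Euclidean norm and $\mathrm{dist}(x,X^* )=\inf_{y\in X^*}\|x-y\|$. Since $c>0$, each local minimization problem in the iteration has a unique minimizer. *)

theory Defs
  imports "HOL-Analysis.Analysis"
begin

text \<open>
  Since the blocks of a vector may have different dimensions, the product
  $R^{n_1} \times \dots \times R^{n_m}$ is represented as \<open>real ^ 'n\<close> together with a map
  \<open>b :: 'n \<Rightarrow> 'm\<close> that sends every coordinate to the index of the block it belongs to. Thus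
  $m$ is \<open>CARD('m)\<close> and $n_i$ is the number of coordinates \<open>j\<close> with \<open>b j = i\<close>; as \<open>'n\<close>, \<open>'m\<close>
  and \<open>b\<close> are arbitrary, so are $m$ and the $n_i$.

  The factor $R^{n_i}$ is identified with the subspace \<open>block_space b i\<close> of the vectors that vanish
  outside block \<open>i\<close>. The identification is a linear isometry, so norm, convexity and compactness
  are the ones of \<open>real ^ 'n\<close>.
\<close>

definition block_space :: "('n::finite \<Rightarrow> 'm::finite) \<Rightarrow> 'm \<Rightarrow> (real ^ 'n) set" where
  "block_space b i = {z. \<forall>j. b j \<noteq> i \<longrightarrow> z $ j = 0}"

definition block :: "('n::finite \<Rightarrow> 'm::finite) \<Rightarrow> 'm \<Rightarrow> real ^ 'n \<Rightarrow> real ^ 'n" where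
  "block b i x = (\<chi> j. if b j = i then x $ j else 0)"

text \<open>The vector $(z^i, x^{-i})$:\<close>

definition replace_block ::
    "('n::finite \<Rightarrow> 'm::finite) \<Rightarrow> 'm \<Rightarrow> real ^ 'n \<Rightarrow> real ^ 'n \<Rightarrow> real ^ 'n" where
  "replace_block b i z x = (\<chi> j. if b j = i then z $ j else x $ j)"

text \<open>The Cartesian product $X^1 \times \dots \times X^m$, for \<open>X i \<subseteq> block_space b i\<close>:\<close>

definition block_product ::
    "('n::finite \<Rightarrow> 'm::finite) \<Rightarrow> ('m \<Rightarrow> (real ^ 'n) set) \<Rightarrow> (real ^ 'n) set" where
  "block_product b X = {x. \<forall>i. block b i x \<in> X i}"

definition minimizers :: "('a \<Rightarrow> real) \<Rightarrow> 'a set \<Rightarrow> 'a set" where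
  "minimizers f S = {x. is_arg_min f (\<lambda>y. y \<in> S) x}"

text \<open>
  \<open>arg_min_on\<close> chooses some minimizer over the given set. Below it is applied to a continuous,
  strictly convex function on a non-empty compact convex set, so the minimizer exists and is unique.
\<close>

definition regularized_jacobi ::
    "('n::finite \<Rightarrow> 'm::finite) \<Rightarrow> (real ^ 'n \<Rightarrow> real) \<Rightarrow> ('m \<Rightarrow> (real ^ 'n) set) \<Rightarrow> real
      \<Rightarrow> (nat \<Rightarrow> real ^ 'n) \<Rightarrow> bool" where
  "regularized_jacobi b f X c x \<longleftrightarrow>
    (\<forall>k i. block b i (x (Suc k)) =
       arg_min_on (\<lambda>z. f (replace_block b i z (x k)) + c * (norm (z - block b i (x k)))\<^sup>2) (X i))"

end

theory Submission
  imports Defs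
begin

text \<open>
  Let \<open>y\<close> be the Jacobi successor of \<open>x\<close>, put \<open>d = y - x\<close>, let \<open>d\<^sub>i\<close> be the \<open>i\<close>-th block of
  \<open>d\<close>, and let \<open>S\<close> be the product of the sets \<open>X\<^sup>i\<close>. The objective decreases along the iteration,
  although all blocks are updated simultaneously, because two bounds can be combined.

  The first bound comes from convexity. The point \<open>x + d / m\<close> is the average of the \<open>m\<close> points
  \<open>x + d\<^sub>i\<close>, and each of these improves on \<open>x\<close> by at least \<open>2c \<parallel>d\<^sub>i\<parallel>\<^sup>2\<close>: the first-order
  condition of the \<open>i\<close>-th local problem, tested against the old block, bounds the slope of \<open>f\<close> at
  \<open>x + d\<^sub>i\<close> in the direction \<open>d\<^sub>i\<close> by \<open>-2c \<parallel>d\<^sub>i\<parallel>\<^sup>2\<close>. Hence \<open>f (x + d / m) \<le> f x - 2c \<parallel>d\<parallel>\<^sup>2 / m\<close>.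

  The second bound covers the remaining way from \<open>x + d / m\<close> to \<open>y\<close>. The same condition
  speaks of the gradient at \<open>x + d\<^sub>i\<close>, and replacing that point by \<open>y\<close> costs at
  most \<open>L \<parallel>d\<parallel>\<close>. Summing over the blocks and applying Cauchy--Schwarz gives, for all \<open>w\<close> in \<open>S\<close>,
  \<open>\<langle>\<nabla>f y, y - w\<rangle> \<le> -2c \<langle>d, y - w\<rangle> + \<surd>m L \<parallel>d\<parallel> \<parallel>y - w\<parallel>\<close> (\<open>gradient_at_successor\<close>).
  With \<open>w = x\<close> and convexity, \<open>f y - f (x + d / m) \<le> (1 - 1/m) (\<surd>m L - 2c) \<parallel>d\<parallel>\<^sup>2\<close>.

  Together they give \<open>f y \<le> f x - (2c - (1 - 1/m) \<surd>m L) \<parallel>d\<parallel>\<^sup>2\<close> (\<open>sufficient_decrease\<close>), and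
  the bound on \<open>c\<close> makes the coefficient positive, because \<open>1 - 1/m \<le> 2 (m - 1) / (2m - 1)\<close>. As \<open>f\<close> is
  bounded below on the compact set \<open>S\<close>, the steps \<open>d\<close> tend to \<open>0\<close>. Now \<open>gradient_at_successor\<close>
  is used again, this time with a minimizer \<open>w\<close>: the optimality gap \<open>f y - f w\<close> is at most a constant
  times \<open>\<parallel>d\<parallel> \<parallel>y - w\<parallel>\<close>, so the values converge to the minimum, and by compactness the iterates
  approach the set of minimizers.
\<close>

section \<open>Gradients, minima and minimizing sequences\<close>

lemma GDERIV_along_line:
  assumes "GDERIV f (u + t *\<^sub>R v) :> g"
  shows "DERIV (\<lambda>s. f (u + s *\<^sub>R v)) t :> inner g v"
proof -
  have "((\<lambda>s. u + s *\<^sub>R v) has_derivative (\<lambda>s. s *\<^sub>R v)) (at t)"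
    by (auto intro!: derivative_eq_intros)
  moreover have "(f has_derivative (\<lambda>h. inner h g)) (at (u + t *\<^sub>R v))"
    using assms by (simp add: gderiv_def)
  ultimately have "((\<lambda>s. f (u + s *\<^sub>R v)) has_derivative (\<lambda>s. inner (s *\<^sub>R v) g)) (at t)"
    by (rule has_derivative_compose)
  then show ?thesis
    by (simp add: has_field_derivative_def inner_commute mult_commute_abs)
qed

lemma convex_on_gradient_inequality:
  assumes cvx: "convex_on UNIV f" and grad: "GDERIV f y :> g"
  shows "f y - f w \<le> inner g (y - w)"
proof -
  let ?h = "\<lambda>t::real. f (y + t *\<^sub>R (w - y))"
  have line: "y + ((1 - t) * r + t * s) *\<^sub>R (w - y) =
      (1 - t) *\<^sub>R (y + r *\<^sub>R (w - y)) + t *\<^sub>R (y + s *\<^sub>R (w - y))" for t r s :: real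
    by (simp add: algebra_simps)
  have "convex_on UNIV ?h"
  proof (rule convex_onI)
    fix t r s :: real
    assume "0 < t" "t < 1"
    then show "?h ((1 - t) *\<^sub>R r + t *\<^sub>R s) \<le> (1 - t) * ?h r + t * ?h s"
      using convex_onD[OF cvx, of t] by (simp add: line)
  qed simp
  moreover have "DERIV ?h 0 :> inner g (w - y)"
    by (rule GDERIV_along_line) (simp add: grad)
  ultimately have "inner g (w - y) * (1 - 0) \<le> ?h 1 - ?h 0"
    by (intro convex_on_imp_above_tangent[where A = UNIV]) auto
  then show ?thesis
    by (simp add: inner_diff_right)
qed

lemma first_order_condition:
  assumes "convex S" and u: "u \<in> S" and z: "z \<in> S"
    and min: "\<And>w. w \<in> S \<Longrightarrow> f u \<le> f w"
    and grad: "GDERIV f u :> g"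
  shows "0 \<le> inner g (z - u)"
proof (rule ccontr)
  assume neg: "\<not> 0 \<le> inner g (z - u)"
  have "DERIV (\<lambda>t. f (u + t *\<^sub>R (z - u))) 0 :> inner g (z - u)"
    by (rule GDERIV_along_line) (simp add: grad)
  from DERIV_neg_dec_right[OF this] neg obtain e where "e > 0"
    and dec: "\<And>h. 0 < h \<Longrightarrow> h < e \<Longrightarrow> f (u + h *\<^sub>R (z - u)) < f u"
    by auto
  define h where "h = min 1 (e / 2)"
  have h: "0 < h" "h \<le> 1" "h < e"
    using \<open>e > 0\<close> by (auto simp: h_def)
  have "(1 - h) *\<^sub>R u + h *\<^sub>R z \<in> S"
    using \<open>convex S\<close> u z h by (intro convexD) auto
  then have "u + h *\<^sub>R (z - u) \<in> S"
    by (simp add: algebra_simps)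
  with min dec[of h] h show False
    by force
qed

lemma arg_min_on_compact:
  fixes f :: "'a::topological_space \<Rightarrow> real"
  assumes "compact S" "S \<noteq> {}" "continuous_on S f"
  shows "is_arg_min f (\<lambda>z. z \<in> S) (arg_min_on f S)"
proof -
  obtain u where "u \<in> S" "\<forall>y\<in>S. f u \<le> f y"
    using continuous_attains_inf[OF assms] by blast
  then have "\<exists>u. is_arg_min f (\<lambda>z. z \<in> S) u"
    by (auto simp: is_arg_min_linorder)
  then show ?thesis
    unfolding arg_min_on_def arg_min_def by (rule someI_ex)
qed

text \<open>
  Points of \<open>S\<close> at distance at least \<open>e\<close> from the minimizers form a compact set, on which the
  continuous function \<open>f\<close> stays above its minimum by a fixed amount.
\<close>

lemma minimizing_sequence_approaches_minimizers:
  fixes f :: "'a::metric_space \<Rightarrow> real"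
  assumes S: "compact S" and cont: "continuous_on S f"
    and u: "u \<in> S" "\<And>w. w \<in> S \<Longrightarrow> f u \<le> f w"
    and x: "\<And>k. x k \<in> S" and lim: "(\<lambda>k. f (x k)) \<longlonglongrightarrow> f u"
  shows "(\<lambda>k. infdist (x k) (minimizers f S)) \<longlonglongrightarrow> 0"
proof (rule LIMSEQ_I)
  fix e :: real
  assume "e > 0"
  let ?M = "minimizers f S"
  define K where "K = {w \<in> S. e \<le> infdist w ?M}"
  have "closed {w. e \<le> infdist w ?M}"
    by (intro closed_Collect_le continuous_intros)
  then have "compact K"
    using S compact_Int_closed[of S] by (simp add: K_def Collect_conj_eq)
  have "\<forall>\<^sub>F k in sequentially. x k \<notin> K"
  proof (cases "K = {}")
    case False
    moreover have "continuous_on K f"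
      using cont by (rule continuous_on_subset) (auto simp: K_def)
    ultimately obtain v where v: "v \<in> K" "\<And>w. w \<in> K \<Longrightarrow> f v \<le> f w"
      using continuous_attains_inf[OF \<open>compact K\<close>] by blast
    have "v \<notin> ?M"
      using v(1) \<open>e > 0\<close> by (auto simp: K_def)
    then have "f u < f v"
      using v(1) u by (force simp: K_def minimizers_def is_arg_min_linorder)
    with lim have "\<forall>\<^sub>F k in sequentially. f (x k) < f v"
      by (rule order_tendstoD)
    then show ?thesis
      by eventually_elim (use v(2) in force)
  qed simp
  then show "\<exists>N. \<forall>k\<ge>N. norm (infdist (x k) ?M - 0) < e"
    using x by (force simp: eventually_sequentially K_def infdist_nonneg)
qed

section \<open>Block decomposition\<close>

lemma block_diff: "block b i (x - y) = block b i x - block b i y"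
  by (simp add: block_def vec_eq_iff)

lemma replace_block_eq:
  assumes "z \<in> block_space b i"
  shows "replace_block b i z x = (x - block b i x) + z"
  using assms by (auto simp: replace_block_def block_def block_space_def vec_eq_iff)

lemma sum_block: "(\<Sum>i\<in>UNIV. block b i x) = x"
  by (simp add: vec_eq_iff block_def)

lemma inner_block_right:
  "inner v (block b i w) = inner (block b i v) (block b i w)"
  by (auto simp: inner_vec_def block_def intro!: sum.cong)

lemma inner_eq_sum_blocks:
  "inner v w = (\<Sum>i\<in>UNIV. inner (block b i v) (block b i w))"
proof -
  have "inner v w = inner v (\<Sum>i\<in>UNIV. block b i w)"
    by (simp only: sum_block)
  then show ?thesis
    by (simp add: inner_sum_right inner_block_right[of v])
qed

lemma norm_minus_block_le: "norm (x - block b i x) \<le> norm x"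
  by (rule norm_le_componentwise_cart) (simp add: block_def)

lemma sum_norm_block_le:
  fixes b :: "'n::finite \<Rightarrow> 'm::finite"
  shows "(\<Sum>i\<in>UNIV. norm (block b i x)) \<le> sqrt (real CARD('m)) * norm x"
proof (rule power2_le_imp_le)
  have "(\<Sum>i\<in>UNIV. norm (block b i x))\<^sup>2 \<le> (\<Sum>i\<in>UNIV. (norm (block b i x))\<^sup>2) * CARD('m)"
    by (rule sum_squared_le_sum_of_squares)
  also have "(\<Sum>i\<in>UNIV. (norm (block b i x))\<^sup>2) = (norm x)\<^sup>2"
    by (simp add: power2_norm_eq_inner inner_eq_sum_blocks[of x x b])
  finally show "(\<Sum>i\<in>UNIV. norm (block b i x))\<^sup>2 \<le> (sqrt (real CARD('m)) * norm x)\<^sup>2"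
    by (simp add: power_mult_distrib mult.commute)
qed simp

lemma block_product_single_update:
  assumes "x \<in> block_product b X" "y \<in> block_product b X"
  shows "x + block b i (y - x) \<in> block_product b X"
proof -
  have "block b j (x + block b i (y - x)) = (if j = i then block b j y else block b j x)" for j
    by (auto simp: block_def vec_eq_iff)
  with assms show ?thesis
    by (simp add: block_product_def)
qed

lemma compact_block_product:
  fixes X :: "'m::finite \<Rightarrow> (real ^ 'n::finite) set"
  assumes "\<And>i. compact (X i)"
  shows "compact (block_product b X)"
proof -
  have cont: "continuous_on UNIV (block b i)" for i
    unfolding block_def
  proof (rule continuous_on_vec_lambda)
    show "continuous_on UNIV (\<lambda>x. if b j = i then x $ j else 0)" for j
      by (cases "b j = i") (auto intro: continuous_on_component continuous_on_id)
  qed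
  have "closed (block b i -` X i)" for i
    by (intro continuous_closed_vimage compact_imp_closed assms)
      (use cont in \<open>simp add: continuous_on_eq_continuous_at\<close>)
  moreover have "block_product b X = (\<Inter>i. block b i -` X i)"
    by (auto simp: block_product_def)
  ultimately have closed: "closed (block_product b X)"
    by auto
  have "\<exists>B. \<forall>z\<in>X i. norm z \<le> B" for i
    using compact_imp_bounded[OF assms] by (auto simp: bounded_iff)
  then obtain B where B: "\<And>i z. z \<in> X i \<Longrightarrow> norm z \<le> B i"
    by metis
  have "norm x \<le> (\<Sum>i\<in>UNIV. B i)" if "x \<in> block_product b X" for x
  proof -
    have "norm x = norm (\<Sum>i\<in>UNIV. block b i x)"
      by (simp add: sum_block)
    also have "\<dots> \<le> (\<Sum>i\<in>UNIV. norm (block b i x))"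
      by (rule norm_sum)
    also have "\<dots> \<le> (\<Sum>i\<in>UNIV. B i)"
      using that by (intro sum_mono B) (simp add: block_product_def)
    finally show ?thesis .
  qed
  then have "bounded (block_product b X)"
    by (auto simp: bounded_iff)
  with closed show ?thesis
    by (simp add: compact_eq_bounded_closed)
qed

section \<open>One step of the regularized Jacobi iteration\<close>

definition jacobi_successor ::
    "('n::finite \<Rightarrow> 'm::finite) \<Rightarrow> (real ^ 'n \<Rightarrow> real) \<Rightarrow> ('m \<Rightarrow> (real ^ 'n) set) \<Rightarrow> real
      \<Rightarrow> real ^ 'n \<Rightarrow> real ^ 'n \<Rightarrow> bool" where
  "jacobi_successor b f X c x y \<longleftrightarrow>
    (\<forall>i. is_arg_min (\<lambda>z. f (replace_block b i z x) + c * (norm (z - block b i x))\<^sup>2)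
       (\<lambda>z. z \<in> X i) (block b i y))"

lemma jacobi_successor_in_block_product:
  "jacobi_successor b f X c x y \<Longrightarrow> y \<in> block_product b X"
  by (simp add: jacobi_successor_def block_product_def is_arg_min_def)

text \<open>
  Each local objective is continuous on a non-empty compact set, so a minimizer exists and the one
  picked by \<open>arg_min_on\<close> is genuine.
\<close>

lemma regularized_jacobi_successor:
  assumes "regularized_jacobi b f X c x" and "continuous_on UNIV f"
    and "\<And>i. X i \<noteq> {}" and "\<And>i. compact (X i)"
  shows "jacobi_successor b f X c (x k) (x (Suc k))"
  unfolding jacobi_successor_def
proof
  fix i
  have "continuous_on (X i) (\<lambda>z. replace_block b i z (x k))"
    unfolding replace_block_def
  proof (rule continuous_on_vec_lambda)
    show "continuous_on (X i) (\<lambda>z. if b j = i then z $ j else x k $ j)" for j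
      by (cases "b j = i") (auto intro: continuous_on_component continuous_on_id)
  qed
  then have "continuous_on (X i) (\<lambda>z. f (replace_block b i z (x k)))"
    by (rule continuous_on_compose2[OF assms(2)]) simp
  then have "continuous_on (X i)
      (\<lambda>z. f (replace_block b i z (x k)) + c * (norm (z - block b i (x k)))\<^sup>2)"
    by (intro continuous_intros)
  from arg_min_on_compact[OF assms(4,3) this] assms(1)
  show "is_arg_min (\<lambda>z. f (replace_block b i z (x k)) + c * (norm (z - block b i (x k)))\<^sup>2)
      (\<lambda>z. z \<in> X i) (block b i (x (Suc k)))"
    by (simp add: regularized_jacobi_def)
qed

locale smooth_convex_block_problem =
  fixes b :: "'n::finite \<Rightarrow> 'm::finite"
    and f :: "real ^ 'n \<Rightarrow> real"
    and grad_f :: "real ^ 'n \<Rightarrow> real ^ 'n"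
    and X :: "'m \<Rightarrow> (real ^ 'n) set"
    and L :: real
  assumes grad: "GDERIV f y :> grad_f y"
    and cvx: "convex_on UNIV f"
    and X_subspace: "X i \<subseteq> block_space b i"
    and X_convex: "convex (X i)"
    and lipschitz: "L-lipschitz_on (block_product b X) grad_f"
begin

text \<open>
  On \<open>block_space b i\<close> replacing the block is the translation by \<open>x - block b i x\<close>, so the local
  objective may be differentiated there as a function on the whole space.
\<close>

lemma local_first_order_condition:
  assumes succ: "jacobi_successor b f X c x y" and z: "z \<in> X i"
  shows "inner (grad_f (x + block b i (y - x))) (block b i y - z)
    \<le> - 2 * c * inner (block b i (y - x)) (block b i y - z)"
proof -
  let ?u = "block b i y" and ?p = "x - block b i x"
  let ?h = "\<lambda>z. f (?p + z) + c * (norm (z - block b i x))\<^sup>2"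
  have min: "is_arg_min (\<lambda>z. f (replace_block b i z x) + c * (norm (z - block b i x))\<^sup>2)
      (\<lambda>z. z \<in> X i) ?u"
    using succ by (simp add: jacobi_successor_def)
  then have u: "?u \<in> X i"
    by (simp add: is_arg_min_def)
  have h_min: "?h ?u \<le> ?h w" if "w \<in> X i" for w
  proof -
    have "replace_block b i v x = ?p + v" if "v \<in> X i" for v
      using that X_subspace by (intro replace_block_eq) blast
    with min that show ?thesis
      by (simp add: is_arg_min_linorder u)
  qed
  have "(f has_derivative (\<lambda>v. inner v (grad_f (?p + ?u)))) (at (?p + ?u))"
    using grad by (simp add: gderiv_def)
  then have "((\<lambda>z. f (?p + z)) has_derivative (\<lambda>v. inner v (grad_f (?p + ?u)))) (at ?u)"
    by (rule has_derivative_compose[rotated]) (auto intro!: derivative_eq_intros)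
  moreover have "((\<lambda>z. c * (norm (z - block b i x))\<^sup>2) has_derivative
      (\<lambda>v. inner v ((2 * c) *\<^sub>R (?u - block b i x)))) (at ?u)"
    unfolding power2_norm_eq_inner
    by (auto intro!: derivative_eq_intros simp: inner_commute algebra_simps)
  ultimately have "(?h has_derivative (\<lambda>v. inner v (grad_f (?p + ?u)) +
      inner v ((2 * c) *\<^sub>R (?u - block b i x)))) (at ?u)"
    by (rule has_derivative_add)
  then have "GDERIV ?h ?u :> grad_f (?p + ?u) + (2 * c) *\<^sub>R (?u - block b i x)"
    by (simp only: gderiv_def inner_add_right)
  from first_order_condition[OF X_convex u z h_min this]
  have "0 \<le> inner (grad_f (?p + ?u) + (2 * c) *\<^sub>R (?u - block b i x)) (z - ?u)" .
  moreover have "?p + ?u = x + block b i (y - x)"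
    by (simp add: block_diff)
  ultimately show ?thesis
    by (simp add: block_diff inner_add_left inner_diff_right algebra_simps)
qed

text \<open>
  Summing the local conditions over \<open>i\<close> would give \<open>-2c \<langle>y - x, y - w\<rangle>\<close> exactly if all gradients
  were taken at \<open>y\<close>. They are taken at points that differ from \<open>y\<close> by the blocks other than \<open>i\<close> of
  \<open>y - x\<close>, which the Lipschitz condition absorbs.
\<close>

lemma gradient_at_successor:
  assumes x: "x \<in> block_product b X" and succ: "jacobi_successor b f X c x y"
    and w: "w \<in> block_product b X"
  shows "inner (grad_f y) (y - w)
    \<le> - 2 * c * inner (y - x) (y - w) + sqrt (real CARD('m)) * L * norm (y - x) * norm (y - w)"
proof -
  let ?d = "y - x"
  have y: "y \<in> block_product b X"
    using succ by (rule jacobi_successor_in_block_product)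
  have L: "L \<ge> 0"
    using lipschitz by (rule lipschitz_on_nonneg)
  have local: "inner (grad_f y) (block b i (y - w))
      \<le> - 2 * c * inner (block b i ?d) (block b i (y - w)) + L * norm ?d * norm (block b i (y - w))"
    for i
  proof -
    let ?x = "x + block b i ?d"
    have "norm (grad_f y - grad_f ?x) \<le> L * norm (y - ?x)"
      using lipschitz_onD[OF lipschitz y block_product_single_update[OF x y, of i]]
      by (simp add: dist_norm)
    also have "norm (y - ?x) \<le> norm ?d"
    proof -
      have "y - ?x = ?d - block b i ?d"
        by simp
      then show ?thesis
        by (simp only: norm_minus_block_le)
    qed
    finally have diff: "norm (grad_f y - grad_f ?x) \<le> L * norm ?d"
      using L by (simp add: mult_left_mono)
    have "inner (grad_f y - grad_f ?x) (block b i (y - w))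
        \<le> norm (grad_f y - grad_f ?x) * norm (block b i (y - w))"
      by (rule norm_cauchy_schwarz)
    also have "\<dots> \<le> L * norm ?d * norm (block b i (y - w))"
      using diff by (rule mult_right_mono) simp
    finally have "inner (grad_f y - grad_f ?x) (block b i (y - w))
        \<le> L * norm ?d * norm (block b i (y - w))" .
    moreover have "inner (grad_f ?x) (block b i (y - w))
        \<le> - 2 * c * inner (block b i ?d) (block b i (y - w))"
      using local_first_order_condition[OF succ, of "block b i w" i] w
      by (simp add: block_product_def block_diff[of b i y w])
    ultimately show ?thesis
      by (simp add: inner_diff_left)
  qed
  have "inner (grad_f y) (y - w) = (\<Sum>i\<in>UNIV. inner (grad_f y) (block b i (y - w)))"
    by (simp add: inner_sum_right[symmetric] sum_block)
  also have "\<dots> \<le> (\<Sum>i\<in>UNIV. - 2 * c * inner (block b i ?d) (block b i (y - w))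
      + L * norm ?d * norm (block b i (y - w)))"
    by (intro sum_mono local)
  also have "\<dots> = - 2 * c * inner ?d (y - w)
      + L * norm ?d * (\<Sum>i\<in>UNIV. norm (block b i (y - w)))"
    by (simp only: sum.distrib sum_distrib_left[symmetric] inner_eq_sum_blocks[of ?d "y - w" b])
  also have "L * norm ?d * (\<Sum>i\<in>UNIV. norm (block b i (y - w)))
      \<le> L * norm ?d * (sqrt (real CARD('m)) * norm (y - w))"
    using L by (intro mult_left_mono sum_norm_block_le) auto
  finally show ?thesis
    by (simp add: mult_ac)
qed

text \<open>
  Bounding \<open>f y - f x\<close> by \<open>gradient_at_successor\<close> alone would leave the error \<open>\<surd>m L \<parallel>y - x\<parallel>\<^sup>2\<close>
  with coefficient \<open>1\<close>. Going through the average of the \<open>m\<close> single-block updates, which is free of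
  this error, lowers the coefficient to \<open>1 - 1/m\<close> and keeps the whole gain \<open>2c \<parallel>y - x\<parallel>\<^sup>2\<close>.
\<close>

lemma sufficient_decrease:
  assumes x: "x \<in> block_product b X" and succ: "jacobi_successor b f X c x y"
  defines "m \<equiv> real CARD('m)"
  shows "f y \<le> f x - (2 * c - (1 - 1 / m) * (sqrt m * L)) * (norm (y - x))\<^sup>2"
proof -
  let ?d = "y - x"
  let ?D = "(norm ?d)\<^sup>2"
  have m: "m \<ge> 1"
    by (simp add: m_def Suc_leI)
  have single: "f (x + block b i ?d) \<le> f x - 2 * c * (norm (block b i ?d))\<^sup>2" for i
  proof -
    let ?x = "x + block b i ?d"
    have "f ?x - f x \<le> inner (grad_f ?x) (block b i ?d)"
      using convex_on_gradient_inequality[OF cvx grad, of ?x x] by simp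
    also have "\<dots> \<le> - 2 * c * inner (block b i ?d) (block b i ?d)"
      using local_first_order_condition[OF succ, of "block b i x" i] x
      by (simp add: block_product_def block_diff)
    finally show ?thesis
      by (simp add: power2_norm_eq_inner)
  qed
  have average: "(\<Sum>i\<in>UNIV. (1 / m) *\<^sub>R (x + block b i ?d)) = x + (1 / m) *\<^sub>R ?d"
  proof -
    have "(\<Sum>i\<in>UNIV. (1 / m) *\<^sub>R (x + block b i ?d)) =
        (1 / m) *\<^sub>R ((\<Sum>i\<in>(UNIV :: 'm set). x) + (\<Sum>i\<in>UNIV. block b i ?d))"
      by (simp only: scaleR_sum_right sum.distrib scaleR_right_distrib)
    also have "(\<Sum>i\<in>(UNIV :: 'm set). x) = m *\<^sub>R x"
      by (simp only: sum_constant_scaleR m_def)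
    also have "(1 / m) *\<^sub>R (m *\<^sub>R x + (\<Sum>i\<in>UNIV. block b i ?d)) = x + (1 / m) *\<^sub>R ?d"
      using m by (simp only: sum_block scaleR_right_distrib) simp
    finally show ?thesis .
  qed
  have "f (x + (1 / m) *\<^sub>R ?d) \<le> (\<Sum>i\<in>UNIV. (1 / m) * f (x + block b i ?d))"
    unfolding average[symmetric] using m
    by (intro convex_on_sum[OF _ _ cvx]) (auto simp: m_def)
  also have "\<dots> \<le> (\<Sum>i\<in>UNIV. (1 / m) * (f x - 2 * c * (norm (block b i ?d))\<^sup>2))"
    using m by (intro sum_mono mult_left_mono single) auto
  also have "\<dots> = (1 / m) * (m * f x - 2 * c * ?D)"
    by (simp add: sum_distrib_left[symmetric] sum_subtractf m_def power2_norm_eq_inner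
        inner_eq_sum_blocks[of ?d ?d b] sum_divide_distrib[symmetric])
  also have "\<dots> = f x - 2 * c * ?D / m"
    using m by (simp add: field_simps)
  finally have first_part: "f (x + (1 / m) *\<^sub>R ?d) \<le> f x - 2 * c * ?D / m" .
  have "f y - f (x + (1 / m) *\<^sub>R ?d) \<le> inner (grad_f y) (y - (x + (1 / m) *\<^sub>R ?d))"
    by (rule convex_on_gradient_inequality[OF cvx grad])
  also have "y - (x + (1 / m) *\<^sub>R ?d) = (1 - 1 / m) *\<^sub>R ?d"
    by (simp add: algebra_simps)
  also have "inner (grad_f y) ((1 - 1 / m) *\<^sub>R ?d) = (1 - 1 / m) * inner (grad_f y) ?d"
    by simp
  also have "\<dots> \<le> (1 - 1 / m) * (- 2 * c * ?D + sqrt m * L * ?D)"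
    using m gradient_at_successor[OF x succ x]
    by (intro mult_left_mono) (auto simp: m_def power2_norm_eq_inner[symmetric] power2_eq_square mult_ac)
  finally have "f y \<le> f x - 2 * c * ?D / m + (1 - 1 / m) * (- 2 * c * ?D + sqrt m * L * ?D)"
    using first_part by simp
  then show ?thesis
    by (simp add: algebra_simps)
qed

lemma optimality_gap:
  assumes x: "x \<in> block_product b X" and succ: "jacobi_successor b f X c x y"
    and w: "w \<in> block_product b X" and "c \<ge> 0"
  shows "f y - f w \<le> (2 * c + sqrt (real CARD('m)) * L) * norm (y - x) * norm (y - w)"
proof -
  have "- inner (y - x) (y - w) \<le> norm (y - x) * norm (y - w)"
    using Cauchy_Schwarz_ineq2[of "y - x" "y - w"] by linarith
  then have "2 * c * - inner (y - x) (y - w) \<le> 2 * c * (norm (y - x) * norm (y - w))"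
    using \<open>c \<ge> 0\<close> by (intro mult_left_mono) auto
  with gradient_at_successor[OF x succ w] convex_on_gradient_inequality[OF cvx grad, of y w]
  show ?thesis
    by (simp add: algebra_simps)
qed

end

section \<open>Convergence\<close>

text \<open>
  The values form a decreasing sequence that is bounded below, so their successive differences, which
  dominate \<open>\<alpha>\<close> times the squared steps, tend to \<open>0\<close>.
\<close>

lemma steps_vanish_of_sufficient_decrease:
  fixes x :: "nat \<Rightarrow> 'a::real_normed_vector" and f :: "'a \<Rightarrow> real"
  assumes "\<alpha> > 0"
    and decrease: "\<And>k. f (x (Suc k)) \<le> f (x k) - \<alpha> * (norm (x (Suc k) - x k))\<^sup>2"
    and bounded: "\<And>k. l \<le> f (x k)"
  shows "(\<lambda>k. norm (x (Suc k) - x k)) \<longlonglongrightarrow> 0"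
proof -
  have "f (x (Suc k)) \<le> f (x k)" for k
    using decrease[of k] \<open>\<alpha> > 0\<close> by (smt (verit) mult_nonneg_nonneg zero_le_power2)
  then have "decseq (\<lambda>k. f (x k))"
    by (rule decseq_SucI)
  then obtain a where a: "(\<lambda>k. f (x k)) \<longlonglongrightarrow> a"
    using decseq_convergent bounded by blast
  from tendsto_diff[OF a LIMSEQ_Suc[OF a]]
  have "(\<lambda>k. (f (x k) - f (x (Suc k))) / \<alpha>) \<longlonglongrightarrow> 0"
    using \<open>\<alpha> > 0\<close> by (auto intro: tendsto_divide_zero)
  then have "(\<lambda>k. (norm (x (Suc k) - x k))\<^sup>2) \<longlonglongrightarrow> 0"
  proof (rule Lim_null_comparison[rotated])
    show "\<forall>\<^sub>F k in sequentially. norm ((norm (x (Suc k) - x k))\<^sup>2)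
        \<le> (f (x k) - f (x (Suc k))) / \<alpha>"
      using decrease \<open>\<alpha> > 0\<close> by (intro always_eventually) (simp add: field_simps)
  qed
  then have "(\<lambda>k. sqrt ((norm (x (Suc k) - x k))\<^sup>2)) \<longlonglongrightarrow> sqrt 0"
    by (rule tendsto_real_sqrt)
  then show ?thesis
    by simp
qed

theorem theorem2:
  fixes b :: "'n::finite \<Rightarrow> 'm::finite"
    and f :: "real ^ 'n \<Rightarrow> real"
    and grad_f :: "real ^ 'n \<Rightarrow> real ^ 'n"
    and X :: "'m \<Rightarrow> (real ^ 'n) set"
    and L c :: real
    and x :: "nat \<Rightarrow> real ^ 'n"
  assumes "\<And>y. GDERIV f y :> grad_f y"
    and "continuous_on UNIV grad_f"
    and "convex_on UNIV f"
    and "\<And>i. X i \<subseteq> block_space b i"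
    and "\<And>i. X i \<noteq> {}"
    and "\<And>i. compact (X i)"
    and "\<And>i. convex (X i)"
    and "L-lipschitz_on (block_product b X) grad_f"
    and "c > (real CARD('m) - 1) / (2 * real CARD('m) - 1) * sqrt (real CARD('m)) * L"
    and "x 0 \<in> block_product b X"
    and "regularized_jacobi b f X c x"
  shows "(\<lambda>k. infdist (x k) (minimizers f (block_product b X))) \<longlonglongrightarrow> 0"
proof -
  interpret smooth_convex_block_problem b f grad_f X L
    using assms(1,3,4,7,8) by unfold_locales
  let ?S = "block_product b X"
  define m where "m = real CARD('m)"
  define \<alpha> where "\<alpha> = 2 * c - (1 - 1 / m) * (sqrt m * L)"
  have m: "m \<ge> 1"
    by (simp add: m_def Suc_leI)
  have mL: "sqrt m * L \<ge> 0"
    using lipschitz_on_nonneg[OF assms(8)] m by simp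
  have c: "c > (m - 1) / (2 * m - 1) * (sqrt m * L)"
    using assms(9) by (simp add: m_def mult.assoc)
  have "(m - 1) / (2 * m - 1) * (sqrt m * L) \<ge> 0"
    using m by (intro mult_nonneg_nonneg mL) simp
  with c have "c > 0"
    by linarith
  have "\<alpha> > 0"
  proof -
    have "1 - 1 / m \<le> 2 * ((m - 1) / (2 * m - 1))"
      using m by (simp add: field_simps)
    from mult_right_mono[OF this mL]
    have "(1 - 1 / m) * (sqrt m * L) \<le> 2 * ((m - 1) / (2 * m - 1) * (sqrt m * L))"
      by (simp only: mult.assoc)
    also have "\<dots> < 2 * c"
      using c by (rule mult_strict_left_mono) simp
    finally show ?thesis
      by (simp add: \<alpha>_def)
  qed
  have cont: "continuous_on A f" for A
    using assms(1) unfolding gderiv_def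
    by (intro continuous_at_imp_continuous_on ballI) (rule has_derivative_continuous)
  have succ: "jacobi_successor b f X c (x k) (x (Suc k))" for k
    using assms(11) cont assms(5,6) by (rule regularized_jacobi_successor)
  have x_in: "x k \<in> ?S" for k
    using assms(10) jacobi_successor_in_block_product[OF succ] by (cases k) auto
  have compact: "compact ?S"
    using assms(6) by (rule compact_block_product)
  obtain u where u: "u \<in> ?S" "\<And>w. w \<in> ?S \<Longrightarrow> f u \<le> f w"
    using continuous_attains_inf[OF compact _ cont] x_in by blast
  have steps: "(\<lambda>k. norm (x (Suc k) - x k)) \<longlonglongrightarrow> 0"
    using \<open>\<alpha> > 0\<close> sufficient_decrease[OF x_in succ] u(2)[OF x_in]
    by (intro steps_vanish_of_sufficient_decrease[of \<alpha> f x "f u"]) (simp_all add: \<alpha>_def m_def)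
  obtain R where R: "\<And>w. w \<in> ?S \<Longrightarrow> norm (w - u) \<le> R"
    using compact_imp_bounded[OF compact] unfolding bounded_any_center[of _ u]
    by (auto simp: dist_norm norm_minus_commute)
  define C where "C = (2 * c + sqrt m * L) * R"
  have "(\<lambda>k. f (x (Suc k)) - f u) \<longlonglongrightarrow> 0"
  proof (rule Lim_null_comparison)
    show "(\<lambda>k. C * norm (x (Suc k) - x k)) \<longlonglongrightarrow> 0"
      using steps by (rule tendsto_mult_right_zero)
    have "norm (f (x (Suc k)) - f u) \<le> C * norm (x (Suc k) - x k)" for k
    proof -
      have "norm (f (x (Suc k)) - f u) = f (x (Suc k)) - f u"
        using u(2)[OF x_in] by simp
      also have "\<dots> \<le> (2 * c + sqrt m * L) * norm (x (Suc k) - x k) * norm (x (Suc k) - u)"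
        unfolding m_def using optimality_gap[OF x_in succ u(1)] \<open>c > 0\<close> by simp
      also have "\<dots> \<le> (2 * c + sqrt m * L) * norm (x (Suc k) - x k) * R"
        using R[OF x_in] \<open>c > 0\<close> mL by (intro mult_left_mono) auto
      finally show ?thesis
        by (simp add: C_def mult_ac)
    qed
    then show "\<forall>\<^sub>F k in sequentially. norm (f (x (Suc k)) - f u) \<le> C * norm (x (Suc k) - x k)"
      by simp
  qed
  then have "(\<lambda>k. f (x k)) \<longlonglongrightarrow> f u"
    by (rule LIMSEQ_imp_Suc[OF LIM_zero_cancel])
  with compact cont u x_in show ?thesis
    by (rule minimizing_sequence_approaches_minimizers)
qed

end
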